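(* Let $b\in\mathbb{R}$, $b\neq 0$, and consider the planar system $\dot x=y$, $\dot y=2bxy$. In the chart $U_2$ of its Poincaré compactification the system is $$\dot u = v-2bu^{2},\qquad \dot v = -2buv,$$ and the critical point $(u,v)=(0,0)$ of this system has one hyperbolic sector and one elliptic sector.
   Context: For a polynomial vector field $\dot x=P(x,y)$, $\dot y=Q(x,y)$ of degree $d$, its expression in the chart $U_2$ of the Poincaré compactification (coordinates $u=x/y$, $v=1/y$, with the points at infinity given by $v=0$) is $\dot u=v^{d}\left[P\left(\frac uv,\frac1v\right)-uQ\left(\frac uv,\frac1v\right)\right]$, $\dot v=-v^{d+1}Q\left(\frac uv,\frac1v\right)$. The local phase portrait of an isolated critical point is decomposed into sectors: hyperbolic (orbits enter and leave the neighbourhood without tending to the point, as at a saddle), elliptic (containing orbits that tend to the point both as $t\to+\infty$ and as $t\to-\infty$), and parabolic (orbits tend to the point in exactly one time direction). The statement counts the hyperbolic and elliptic sectors; parabolic sectors are not counted. *)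

theory Defs
  imports "HOL-Analysis.Analysis"
begin

section \<open>Degree of a polynomial vector field and the chart \<open>U\<^sub>2\<close>\<close>

definition poly_le :: "nat \<Rightarrow> (real \<times> real \<Rightarrow> real) \<Rightarrow> bool" where
  "poly_le n f \<longleftrightarrow>
     (\<exists>a :: nat \<Rightarrow> nat \<Rightarrow> real. \<forall>x y. f (x, y) = (\<Sum>i\<le>n. \<Sum>j\<le>n - i. a i j * x ^ i * y ^ j))"

text \<open>The maximum of the total degrees of the two components; meaningful only for
  polynomial vector fields.\<close>

definition vf_degree :: "(real \<times> real \<Rightarrow> real \<times> real) \<Rightarrow> nat" where
  "vf_degree X = (LEAST n. poly_le n (\<lambda>z. fst (X z)) \<and> poly_le n (\<lambda>z. snd (X z)))"

definition chart_U2_finite ::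
    "(real \<times> real \<Rightarrow> real \<times> real) \<Rightarrow> real \<Rightarrow> real \<Rightarrow> real \<times> real" where
  "chart_U2_finite X u v =
     (let d = vf_degree X; P = fst (X (u / v, 1 / v)); Q = snd (X (u / v, 1 / v))
      in (v ^ d * (P - u * Q), - (v ^ (d + 1) * Q)))"

text \<open>For a polynomial vector field the formula above is polynomial in \<open>(u, v)\<close> after
  cancellation. Since \<open>1 / 0 = 0\<close> here, its value on the line at infinity \<open>v = 0\<close> has to be
  taken as the limit.\<close>

definition chart_U2 :: "(real \<times> real \<Rightarrow> real \<times> real) \<Rightarrow> real \<times> real \<Rightarrow> real \<times> real" where
  "chart_U2 X = (\<lambda>(u, v). if v \<noteq> 0 then chart_U2_finite X u v
                          else Lim (at 0) (\<lambda>w. chart_U2_finite X u w))"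

section \<open>Sectors at a critical point\<close>

text \<open>All vector fields are meant to be \<open>C\<^sup>1\<close>, so that a solution is determined by its initial
  value and existence of a solution with some behaviour says that \<^emph>\<open>the\<close> solution has it.
  Behaviour backwards in time is behaviour forwards in time for the field \<open>- X\<close>.\<close>

definition solution_on ::
    "(real \<times> real \<Rightarrow> real \<times> real) \<Rightarrow> (real \<Rightarrow> real \<times> real) \<Rightarrow> real set \<Rightarrow> bool" where
  "solution_on X \<gamma> I \<longleftrightarrow> (\<forall>t\<in>I. (\<gamma> has_vector_derivative X (\<gamma> t)) (at t within I))"

definition reversed :: "(real \<times> real \<Rightarrow> real \<times> real) \<Rightarrow> real \<times> real \<Rightarrow> real \<times> real" where
  "reversed X = (\<lambda>z. - X z)"

definition isolated_critical_point :: "(real \<times> real \<Rightarrow> real \<times> real) \<Rightarrow> real \<times> real \<Rightarrow> bool" where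
  "isolated_critical_point X p \<longleftrightarrow> X p = 0 \<and> (\<forall>\<^sub>F z in at p. X z \<noteq> 0)"

definition tends_in ::
    "(real \<times> real \<Rightarrow> real \<times> real) \<Rightarrow> (real \<times> real) set \<Rightarrow> real \<times> real \<Rightarrow> real \<times> real \<Rightarrow> bool" where
  "tends_in X S p q \<longleftrightarrow>
     (\<exists>\<gamma>. solution_on X \<gamma> {0..} \<and> \<gamma> 0 = q \<and> \<gamma> ` {0..} \<subseteq> S \<and> (\<gamma> \<longlongrightarrow> p) at_top)"

definition leaves ::
    "(real \<times> real \<Rightarrow> real \<times> real) \<Rightarrow> (real \<times> real) set \<Rightarrow> real \<times> real \<Rightarrow> bool" where
  "leaves X S q \<longleftrightarrow> (\<exists>\<gamma> T. 0 < T \<and> solution_on X \<gamma> {0..T} \<and> \<gamma> 0 = q \<and> \<gamma> T \<notin> S)"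

text \<open>Intended for a Jordan curve \<open>J\<close>: the closed topological disc that it bounds.\<close>

definition closed_disc :: "(real \<times> real) set \<Rightarrow> (real \<times> real) set" where
  "closed_disc J = J \<union> inside J"

datatype sector_kind = Hyperbolic | Elliptic | Parabolic

text \<open>In the sector predicates \<open>S\<close> is the closed sector, including \<open>p\<close>. For a hyperbolic sector,
  \<open>B\<close> consists of \<open>p\<close> and the two half orbits bounding \<open>S\<close>.\<close>

definition hyperbolic_sector ::
    "(real \<times> real \<Rightarrow> real \<times> real) \<Rightarrow> (real \<times> real) set \<Rightarrow> (real \<times> real) set \<Rightarrow> bool" where
  "hyperbolic_sector X S B \<longleftrightarrow> (\<forall>q\<in>S - B. leaves X S q \<and> leaves (reversed X) S q)"

text \<open>The orbits tending to \<open>p\<close> in both time directions fill the closed disc \<open>D\<close> bounded by the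
  largest of them; the remaining orbits tend to \<open>p\<close> in one time direction and leave \<open>S\<close> in the
  other. (These remaining orbits may also be regarded as parabolic sectors adjacent to the
  elliptic one, which does not affect the number of elliptic sectors.)\<close>

definition elliptic_sector ::
    "(real \<times> real \<Rightarrow> real \<times> real) \<Rightarrow> real \<times> real \<Rightarrow> (real \<times> real) set \<Rightarrow> bool" where
  "elliptic_sector X p S \<longleftrightarrow>
     (\<exists>\<gamma> D. solution_on X \<gamma> UNIV \<and> range \<gamma> \<subseteq> S - {p} \<and>
        (\<gamma> \<longlongrightarrow> p) at_top \<and> (\<gamma> \<longlongrightarrow> p) at_bot \<and>
        D = closed_disc (insert p (range \<gamma>)) \<and> D \<subseteq> S \<and>
        (\<forall>q\<in>D - {p}. tends_in X S p q \<and> tends_in (reversed X) S p q) \<and>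
        (\<forall>q\<in>S - D. tends_in X S p q \<and> leaves (reversed X) S q \<or>
                    leaves X S q \<and> tends_in (reversed X) S p q))"

definition parabolic_sector ::
    "(real \<times> real \<Rightarrow> real \<times> real) \<Rightarrow> real \<times> real \<Rightarrow> (real \<times> real) set \<Rightarrow> bool" where
  "parabolic_sector X p S \<longleftrightarrow>
     (\<forall>q\<in>S - {p}. tends_in X S p q \<and> leaves (reversed X) S q) \<or>
     (\<forall>q\<in>S - {p}. tends_in (reversed X) S p q \<and> leaves X S q)"

text \<open>A half orbit entering the closed disc bounded by the Jordan curve \<open>J\<close> at its point \<open>c 0\<close>
  and then tending to \<open>p\<close> inside it.\<close>

definition characteristic_orbit ::
    "(real \<times> real \<Rightarrow> real \<times> real) \<Rightarrow> real \<times> real \<Rightarrow> (real \<times> real) set \<Rightarrow> (real \<Rightarrow> real \<times> real) \<Rightarrow> bool" where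
  "characteristic_orbit X p J c \<longleftrightarrow>
     (\<exists>e>0. solution_on X c {-e..} \<and> (\<forall>t\<in>{-e..<0}. c t \<notin> closed_disc J)) \<and>
     c 0 \<in> J \<and> (\<forall>t>0. c t \<in> inside J) \<and> (c \<longlongrightarrow> p) at_top"

text \<open>A Jordan curve \<open>g\<close> around \<open>p\<close> is cut at the points \<open>g (s 0), \<dots>, g (s n)\<close>, the last being
  the first again, in which characteristic half orbits \<open>c i\<close> meet it. The flag \<open>\<sigma> i\<close> tells whether
  \<open>c i\<close> tends to \<open>p\<close> forwards in time; otherwise \<open>c i\<close> is parametrised by reversed time. The
  \<open>i\<close>-th sector is bounded by \<open>c i\<close>, \<open>c (i + 1)\<close> and the arc of \<open>g\<close> between them.\<close>

definition sectorial_decomposition ::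
    "(real \<times> real \<Rightarrow> real \<times> real) \<Rightarrow> real \<times> real \<Rightarrow> (real \<times> real) set \<Rightarrow> sector_kind list \<Rightarrow> bool" where
  "sectorial_decomposition X p V ks \<longleftrightarrow>
     (\<exists>(g :: real \<Rightarrow> real \<times> real) (s :: nat \<Rightarrow> real) (c :: nat \<Rightarrow> real \<Rightarrow> real \<times> real)
        (\<sigma> :: nat \<Rightarrow> bool) n.
        n = length ks \<and> 2 \<le> n \<and>
        simple_path g \<and> pathfinish g = pathstart g \<and>
        p \<in> inside (path_image g) \<and> V = closed_disc (path_image g) \<and>
        s 0 = 0 \<and> s n = 1 \<and> (\<forall>i<n. s i < s (i + 1)) \<and>
        c n = c 0 \<and> \<sigma> n = \<sigma> 0 \<and>
        (\<forall>i<n. c i 0 = g (s i) \<and>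
           characteristic_orbit (if \<sigma> i then X else reversed X) p (path_image g) (c i)) \<and>
        (\<forall>i<n. let B = insert p (c i ` {0..} \<union> c (i + 1) ` {0..});
                    S = closed_disc (B \<union> g ` {s i..s (i + 1)})
                in case ks ! i of
                     Hyperbolic \<Rightarrow> \<sigma> i \<noteq> \<sigma> (i + 1) \<and> hyperbolic_sector X S B
                   | Elliptic \<Rightarrow> \<sigma> i \<noteq> \<sigma> (i + 1) \<and> elliptic_sector X p S
                   | Parabolic \<Rightarrow> \<sigma> i = \<sigma> (i + 1) \<and> parabolic_sector X p S))"

text \<open>The local phase portrait at \<open>p\<close> has \<open>h\<close> hyperbolic and \<open>e\<close> elliptic sectors, and any number
  of parabolic ones. Requiring this in arbitrarily small neighbourhoods makes the counts local:
  in a large neighbourhood, a loop through \<open>p\<close> could enclose several smaller elliptic sectors.\<close>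

definition has_sectors ::
    "(real \<times> real \<Rightarrow> real \<times> real) \<Rightarrow> real \<times> real \<Rightarrow> nat \<Rightarrow> nat \<Rightarrow> bool" where
  "has_sectors X p h e \<longleftrightarrow>
     isolated_critical_point X p \<and>
     (\<forall>U. open U \<and> p \<in> U \<longrightarrow>
        (\<exists>V ks. V \<subseteq> U \<and> sectorial_decomposition X p V ks \<and>
                count_list ks Hyperbolic = h \<and> count_list ks Elliptic = e))"

end

(* After the linear change of coordinates diag(c / 2b, c^2 / 2b) and the rescaling of time by c,
   the chart field becomes u' = v - u^2, v' = - u v, for every c > 0; small c shrinks a sectorial
   decomposition on one disc into any neighbourhood. The normal form is solved by u = D' / D,
   v = D'' / D for quadratic polynomials D; with D = 1 + u t + v t^2 / 2 this gives the solution
   ((u + v t) / D, v / D) through (u, v).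
   For v > 0 the orbits with u^2 < 2v are ellipses through the origin, and the one that touches
   the circle of radius 2 bounds the elliptic region; all other points of the upper half disc
   leave it in exactly one time direction. For v < 0 the denominator D vanishes in both time
   directions, so that the orbit blows up: this is the hyperbolic sector. The u-axis carries the
   two separating orbits. *)

theory Submission
  imports Defs "HOL-Real_Asymp.Real_Asymp"
begin

text \<open>For a bounded convex set, the inside of the frontier is the interior. The curves used
  for the normal form are frontiers of discs and half discs, so convexity alone identifies what they
  enclose.\<close>

lemma closed_disc_frontier:
  assumes "compact S" "convex S" shows "closed_disc (frontier S) = S"
proof -
  have "closed_disc (frontier S) = frontier S \<union> interior S"
    using assms by (simp add: closed_disc_def inside_frontier_eq_interior compact_imp_bounded)
  also have "\<dots> = S"
    using assms(1) interior_subset[of S] by (auto simp: frontier_def compact_imp_closed)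
  finally show ?thesis .
qed

section \<open>Transport of sectors along linear conjugacies\<close>

text \<open>The factor \<open>c\<close> is a change of time scale. Its positivity keeps the
  direction of time, on which the sector predicates depend.\<close>

locale field_conjugacy =
  fixes f :: "real \<times> real \<Rightarrow> real \<times> real" and c :: real
    and Y Z :: "real \<times> real \<Rightarrow> real \<times> real"
  assumes linear_f: "linear f" and bij_f: "bij f" and c_pos: "c > 0"
    and conj: "\<And>z. Z (f z) = c *\<^sub>R f (Y z)"
begin

lemma inj_f: "inj f" using bij_f by (rule bij_is_inj)

lemma bounded_linear_f: "bounded_linear f" using linear_f by (simp add: linear_conv_bounded_linear)

lemma bounded_linear_inv: "bounded_linear (inv f)"
  using inj_linear_imp_inv_linear[OF linear_f inj_f] by (simp add: linear_conv_bounded_linear)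

lemma f_mem_iff: "f z \<in> f ` S \<longleftrightarrow> z \<in> S"
  using inj_f by (simp add: inj_image_mem_iff)

lemma bounded_image_iff: "bounded (f ` S) \<longleftrightarrow> bounded S"
proof
  assume "bounded (f ` S)"
  then have "bounded (inv f ` f ` S)" using bounded_linear_inv by (rule bounded_linear_image)
  then show "bounded S" using inj_f by (simp add: image_inv_f_f)
qed (rule bounded_linear_image[OF _ bounded_linear_f])

text \<open>A linear bijection is a homeomorphism between the complements, so it carries components
  to components. Since it and its inverse are bounded, it also preserves which components are
  bounded.\<close>

lemma inside_image: "inside (f ` S) = f ` inside S"
proof -
  have "homeomorphism (- S) (- f ` S) f (inv f)"
  proof (rule homeomorphismI)
    show "f ` (- S) \<subseteq> - f ` S" by (simp add: bij_image_Compl_eq[OF bij_f])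
    show "inv f ` (- f ` S) \<subseteq> - S"
      unfolding bij_image_Compl_eq[OF bij_f, symmetric] by (simp add: inj_f image_inv_f_f)
  qed (simp_all add: inj_f bij_f bij_is_surj surj_f_inv_f linear_continuous_on
      bounded_linear_f bounded_linear_inv)
  note comp = connected_component_set_homeomorphism[OF this]
  have iff: "f x \<in> inside (f ` S) \<longleftrightarrow> x \<in> inside S" for x
    using comp[of x] by (auto simp: inside_def f_mem_iff bounded_image_iff)
  show ?thesis
  proof (intro equalityI subsetI)
    fix z assume "z \<in> inside (f ` S)"
    moreover obtain x where "z = f x" using bij_f by (meson bij_pointE)
    ultimately show "z \<in> f ` inside S" using iff by auto
  next
    fix z assume "z \<in> f ` inside S"
    then show "z \<in> inside (f ` S)" using iff by blast
  qed
qed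

lemma closed_disc_image: "closed_disc (f ` J) = f ` closed_disc J"
  by (simp add: closed_disc_def inside_image image_Un)

text \<open>By the chain rule, running along the orbit \<open>c\<close> times as fast absorbs the
  factor in \<open>conj\<close>. The sets \<open>I\<close> and \<open>K\<close> stay free because
  half-lines, bounded intervals and the whole line all occur.\<close>

lemma solution_on_image:
  assumes "solution_on Y \<gamma> I" "\<And>t. t \<in> K \<Longrightarrow> c * t \<in> I"
  shows "solution_on Z (\<lambda>t. f (\<gamma> (c * t))) K"
  unfolding solution_on_def
proof
  fix t assume t: "t \<in> K"
  have "(\<gamma> has_vector_derivative Y (\<gamma> (c * t))) (at (c * t) within (\<lambda>t. c * t) ` K)"
  proof (rule has_vector_derivative_within_subset)
    show "(\<gamma> has_vector_derivative Y (\<gamma> (c * t))) (at (c * t) within I)"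
      using assms t unfolding solution_on_def by blast
  qed (use assms(2) in blast)
  moreover have "((\<lambda>t. c * t) has_vector_derivative c) (at t within K)"
    by (auto intro!: derivative_eq_intros)
  ultimately have "(\<gamma> \<circ> (\<lambda>t. c * t) has_vector_derivative c *\<^sub>R Y (\<gamma> (c * t))) (at t within K)"
    using vector_diff_chain_within by blast
  from bounded_linear.has_vector_derivative[OF bounded_linear_f this]
  show "((\<lambda>t. f (\<gamma> (c * t))) has_vector_derivative Z (f (\<gamma> (c * t)))) (at t within K)"
    by (simp add: conj o_def linear_scale[OF linear_f])
qed

lemma scaled_time_image: "(\<lambda>t. f (\<gamma> (c * t))) ` {0..} = f ` \<gamma> ` {0..}"
proof -
  have "(\<lambda>t. c * t) ` {0..} = {0..}"
  proof (intro equalityI subsetI)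
    fix x :: real assume "x \<in> {0..}"
    then show "x \<in> (\<lambda>t. c * t) ` {0..}" using c_pos by (intro image_eqI[of _ _ "x / c"]) auto
  qed (use c_pos in auto)
  moreover have "(\<lambda>t. f (\<gamma> (c * t))) ` {0..} = f ` \<gamma> ` (\<lambda>t. c * t) ` {0..}"
    by (simp only: image_image)
  ultimately show ?thesis by simp
qed

lemma scaled_time_range: "range (\<lambda>t. f (\<gamma> (c * t))) = f ` range \<gamma>"
proof -
  have "range (\<lambda>t. c * t) = UNIV"
    using c_pos by (intro surjI[of _ "\<lambda>x. x / c"]) auto
  moreover have "range (\<lambda>t. f (\<gamma> (c * t))) = f ` \<gamma> ` range (\<lambda>t. c * t)"
    by (simp only: image_image)
  ultimately show ?thesis by (simp only:)
qed

lemma tendsto_image: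
  assumes "(\<gamma> \<longlongrightarrow> p) at_top" shows "((\<lambda>t. f (\<gamma> (c * t))) \<longlongrightarrow> f p) at_top"
proof -
  have "filterlim (\<lambda>t. c * t) at_top at_top"
    using c_pos by (intro filterlim_tendsto_pos_mult_at_top[OF tendsto_const _ filterlim_ident])
  from filterlim_compose[OF assms this] show ?thesis
    by (rule bounded_linear.tendsto[OF bounded_linear_f])
qed

lemma tendsto_image_at_bot:
  assumes "(\<gamma> \<longlongrightarrow> p) at_bot" shows "((\<lambda>t. f (\<gamma> (c * t))) \<longlongrightarrow> f p) at_bot"
proof -
  have "filterlim (\<lambda>t. c * t) at_bot at_bot"
    using c_pos by (intro filterlim_tendsto_pos_mult_at_bot[OF tendsto_const _ filterlim_ident])
  from filterlim_compose[OF assms this] show ?thesis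
    by (rule bounded_linear.tendsto[OF bounded_linear_f])
qed

lemma tends_in_image:
  assumes "tends_in Y S p q" shows "tends_in Z (f ` S) (f p) (f q)"
proof -
  obtain \<gamma> where g: "solution_on Y \<gamma> {0..}" "\<gamma> 0 = q" "\<gamma> ` {0..} \<subseteq> S" "(\<gamma> \<longlongrightarrow> p) at_top"
    using assms unfolding tends_in_def by blast
  have "solution_on Z (\<lambda>t. f (\<gamma> (c * t))) {0..}"
    by (rule solution_on_image[OF g(1)]) (use c_pos in auto)
  moreover have "(\<lambda>t. f (\<gamma> (c * t))) ` {0..} \<subseteq> f ` S"
    unfolding scaled_time_image using g(3) by (rule image_mono)
  ultimately show ?thesis
    unfolding tends_in_def using g(2) tendsto_image[OF g(4)]
    by (intro exI[of _ "\<lambda>t. f (\<gamma> (c * t))"]) auto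
qed

lemma leaves_image:
  assumes "leaves Y S q" shows "leaves Z (f ` S) (f q)"
proof -
  obtain \<gamma> T where g: "0 < T" "solution_on Y \<gamma> {0..T}" "\<gamma> 0 = q" "\<gamma> T \<notin> S"
    using assms unfolding leaves_def by blast
  have "solution_on Z (\<lambda>t. f (\<gamma> (c * t))) {0..T / c}"
    by (rule solution_on_image[OF g(2)]) (use c_pos in \<open>auto simp: field_simps\<close>)
  then show ?thesis
    unfolding leaves_def using g c_pos
    by (intro exI[of _ "\<lambda>t. f (\<gamma> (c * t))"] exI[of _ "T / c"]) (auto simp: f_mem_iff)
qed

text \<open>A linear map commutes with negation, so every transport lemma also holds for the
  reversed fields. This yields the statements about backward time.\<close>

lemma conjugacy_reversed: "field_conjugacy f c (reversed Y) (reversed Z)"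
  using linear_f bij_f c_pos
  by (simp add: field_conjugacy_def reversed_def conj linear_neg[OF linear_f])

lemma leaves_reversed_image:
  "leaves (reversed Y) S q \<Longrightarrow> leaves (reversed Z) (f ` S) (f q)"
  using field_conjugacy.leaves_image[OF conjugacy_reversed] .

lemma tends_in_reversed_image:
  "tends_in (reversed Y) S p q \<Longrightarrow> tends_in (reversed Z) (f ` S) (f p) (f q)"
  using field_conjugacy.tends_in_image[OF conjugacy_reversed] .

text \<open>The sector predicates all quantify over a difference of sets, and injectivity lets the
  image pass through that difference.\<close>

lemma ball_image_Diff:
  assumes "\<forall>q\<in>S - B. P q" "\<And>q. P q \<Longrightarrow> Q (f q)"
  shows "\<forall>q\<in>f ` S - f ` B. Q q"
  using assms by (auto simp: image_set_diff[OF inj_f, symmetric])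

lemma hyperbolic_sector_image:
  assumes "hyperbolic_sector Y S B" shows "hyperbolic_sector Z (f ` S) (f ` B)"
  using assms unfolding hyperbolic_sector_def
  by (rule ball_image_Diff) (simp add: leaves_image leaves_reversed_image)

lemma parabolic_sector_image:
  assumes "parabolic_sector Y p S" shows "parabolic_sector Z (f p) (f ` S)"
proof -
  have sing: "{f p} = f ` {p}" by simp
  show ?thesis
    using assms unfolding parabolic_sector_def sing
    by (elim disjE; intro disjI1 disjI2)
      (erule ball_image_Diff;
        simp add: leaves_image leaves_reversed_image tends_in_image tends_in_reversed_image)+
qed

lemma elliptic_sector_image:
  assumes "elliptic_sector Y p S" shows "elliptic_sector Z (f p) (f ` S)"
proof -
  obtain \<gamma> D where
    g: "solution_on Y \<gamma> UNIV" "range \<gamma> \<subseteq> S - {p}" "(\<gamma> \<longlongrightarrow> p) at_top" "(\<gamma> \<longlongrightarrow> p) at_bot"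
    and D: "D = closed_disc (insert p (range \<gamma>))" "D \<subseteq> S"
    and in_D: "\<forall>q\<in>D - {p}. tends_in Y S p q \<and> tends_in (reversed Y) S p q"
    and out_D: "\<forall>q\<in>S - D. tends_in Y S p q \<and> leaves (reversed Y) S q \<or>
                    leaves Y S q \<and> tends_in (reversed Y) S p q"
    using assms unfolding elliptic_sector_def by blast
  have sing: "{f p} = f ` {p}" by simp
  have "solution_on Z (\<lambda>t. f (\<gamma> (c * t))) UNIV"
    by (rule solution_on_image[OF g(1)]) simp
  moreover have "range (\<lambda>t. f (\<gamma> (c * t))) \<subseteq> f ` S - {f p}"
    unfolding scaled_time_range sing image_set_diff[OF inj_f, symmetric] using g(2) by (rule image_mono)
  moreover have "f ` D = closed_disc (insert (f p) (range (\<lambda>t. f (\<gamma> (c * t)))))"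
    unfolding scaled_time_range D(1) closed_disc_image[symmetric] by simp
  moreover have "f ` D \<subseteq> f ` S" using D(2) by (rule image_mono)
  moreover have "\<forall>q\<in>f ` D - {f p}. tends_in Z (f ` S) (f p) q \<and> tends_in (reversed Z) (f ` S) (f p) q"
    unfolding sing using in_D
    by (rule ball_image_Diff) (simp add: tends_in_image tends_in_reversed_image)
  moreover have "\<forall>q\<in>f ` S - f ` D. tends_in Z (f ` S) (f p) q \<and> leaves (reversed Z) (f ` S) q \<or>
                    leaves Z (f ` S) q \<and> tends_in (reversed Z) (f ` S) (f p) q"
    using out_D
    by (rule ball_image_Diff)
      (auto simp: leaves_image leaves_reversed_image tends_in_image tends_in_reversed_image)
  ultimately show ?thesis
    unfolding elliptic_sector_def
    using tendsto_image[OF g(3)] tendsto_image_at_bot[OF g(4)] by blast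
qed

lemma characteristic_orbit_image:
  assumes "characteristic_orbit Y p J \<gamma>"
  shows "characteristic_orbit Z (f p) (f ` J) (\<lambda>t. f (\<gamma> (c * t)))"
proof -
  obtain e where e: "e > 0" "solution_on Y \<gamma> {-e..}" "\<forall>t\<in>{-e..<0}. \<gamma> t \<notin> closed_disc J"
    and g: "\<gamma> 0 \<in> J" "\<forall>t>0. \<gamma> t \<in> inside J" "(\<gamma> \<longlongrightarrow> p) at_top"
    using assms unfolding characteristic_orbit_def by blast
  have time: "- e \<le> c * t" if "- (e / c) \<le> t" for t
    using that c_pos by (simp add: field_simps)
  have "solution_on Z (\<lambda>t. f (\<gamma> (c * t))) {-(e / c)..}"
    by (rule solution_on_image[OF e(2)]) (use time in auto)
  moreover have "\<forall>t\<in>{-(e / c)..<0}. f (\<gamma> (c * t)) \<notin> closed_disc (f ` J)"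
    using e(3) time c_pos by (auto simp: closed_disc_image f_mem_iff mult_less_0_iff)
  moreover have "\<forall>t>0. f (\<gamma> (c * t)) \<in> inside (f ` J)"
    using g(2) c_pos by (auto simp: inside_image f_mem_iff)
  ultimately show ?thesis
    unfolding characteristic_orbit_def using e(1) c_pos g(1) tendsto_image[OF g(3)]
    by (auto intro!: exI[of _ "e / c"])
qed

text \<open>The cut parameters \<open>s\<close> and the time directions \<open>\<sigma>\<close> are
  kept. Only the Jordan curve and the characteristic orbits are mapped, the latter with rescaled
  time.\<close>

lemma sectorial_decomposition_image:
  assumes "sectorial_decomposition Y p V ks"
  shows "sectorial_decomposition Z (f p) (f ` V) ks"
proof -
  let ?n = "length ks"
  obtain g s \<gamma> \<sigma> where n: "2 \<le> ?n"
    and g: "simple_path g" "pathfinish g = pathstart g" "p \<in> inside (path_image g)"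
      "V = closed_disc (path_image g)"
    and s: "s 0 = 0" "s ?n = 1" "\<forall>i<?n. s i < s (i + 1)"
    and \<gamma>: "\<gamma> ?n = \<gamma> 0" "\<sigma> ?n = \<sigma> 0"
      "\<forall>i<?n. \<gamma> i 0 = g (s i) \<and>
           characteristic_orbit (if \<sigma> i then Y else reversed Y) p (path_image g) (\<gamma> i)"
    and sec: "\<forall>i<?n. let B = insert p (\<gamma> i ` {0..} \<union> \<gamma> (i + 1) ` {0..});
                    S = closed_disc (B \<union> g ` {s i..s (i + 1)})
                in case ks ! i of
                     Hyperbolic \<Rightarrow> \<sigma> i \<noteq> \<sigma> (i + 1) \<and> hyperbolic_sector Y S B
                   | Elliptic \<Rightarrow> \<sigma> i \<noteq> \<sigma> (i + 1) \<and> elliptic_sector Y p S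
                   | Parabolic \<Rightarrow> \<sigma> i = \<sigma> (i + 1) \<and> parabolic_sector Y p S"
    using assms unfolding sectorial_decomposition_def by blast
  define \<delta> where "\<delta> i = (\<lambda>t. f (\<gamma> i (c * t)))" for i
  have "simple_path (f \<circ> g)"
    using g(1) linear_f inj_f simple_path_linear_image_eq by blast
  moreover have "pathfinish (f \<circ> g) = pathstart (f \<circ> g)"
    using g(2) by (simp add: pathfinish_def pathstart_def)
  moreover have "f p \<in> inside (path_image (f \<circ> g))"
    using g(3) by (simp add: path_image_compose inside_image)
  moreover have "f ` V = closed_disc (path_image (f \<circ> g))"
    using g(4) by (simp add: path_image_compose closed_disc_image)
  moreover have "\<forall>i<?n. \<delta> i 0 = (f \<circ> g) (s i) \<and>
      characteristic_orbit (if \<sigma> i then Z else reversed Z) (f p) (path_image (f \<circ> g)) (\<delta> i)"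
    using \<gamma>(3) characteristic_orbit_image
      field_conjugacy.characteristic_orbit_image[OF conjugacy_reversed]
    by (simp add: \<delta>_def path_image_compose) metis
  moreover have "\<forall>i<?n. let B = insert (f p) (\<delta> i ` {0..} \<union> \<delta> (i + 1) ` {0..});
                    S = closed_disc (B \<union> (f \<circ> g) ` {s i..s (i + 1)})
                in case ks ! i of
                     Hyperbolic \<Rightarrow> \<sigma> i \<noteq> \<sigma> (i + 1) \<and> hyperbolic_sector Z S B
                   | Elliptic \<Rightarrow> \<sigma> i \<noteq> \<sigma> (i + 1) \<and> elliptic_sector Z (f p) S
                   | Parabolic \<Rightarrow> \<sigma> i = \<sigma> (i + 1) \<and> parabolic_sector Z (f p) S"
  proof (intro allI impI)
    fix i assume i: "i < ?n"
    define B where "B = insert p (\<gamma> i ` {0..} \<union> \<gamma> (i + 1) ` {0..})"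
    define S where "S = closed_disc (B \<union> g ` {s i..s (i + 1)})"
    have fB: "insert (f p) (\<delta> i ` {0..} \<union> \<delta> (i + 1) ` {0..}) = f ` B"
      unfolding B_def \<delta>_def scaled_time_image by (simp only: image_insert image_Un)
    have fS: "closed_disc (f ` B \<union> (f \<circ> g) ` {s i..s (i + 1)}) = f ` S"
      unfolding S_def closed_disc_image[symmetric] by (simp only: image_comp image_Un)
    have "case ks ! i of
                     Hyperbolic \<Rightarrow> \<sigma> i \<noteq> \<sigma> (i + 1) \<and> hyperbolic_sector Y S B
                   | Elliptic \<Rightarrow> \<sigma> i \<noteq> \<sigma> (i + 1) \<and> elliptic_sector Y p S
                   | Parabolic \<Rightarrow> \<sigma> i = \<sigma> (i + 1) \<and> parabolic_sector Y p S"
      using sec i unfolding S_def B_def Let_def by blast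
    then show "let B = insert (f p) (\<delta> i ` {0..} \<union> \<delta> (i + 1) ` {0..});
                    S = closed_disc (B \<union> (f \<circ> g) ` {s i..s (i + 1)})
                in case ks ! i of
                     Hyperbolic \<Rightarrow> \<sigma> i \<noteq> \<sigma> (i + 1) \<and> hyperbolic_sector Z S B
                   | Elliptic \<Rightarrow> \<sigma> i \<noteq> \<sigma> (i + 1) \<and> elliptic_sector Z (f p) S
                   | Parabolic \<Rightarrow> \<sigma> i = \<sigma> (i + 1) \<and> parabolic_sector Z (f p) S"
      unfolding Let_def fB fS
      using hyperbolic_sector_image elliptic_sector_image parabolic_sector_image
      by (simp split: sector_kind.splits)
  qed
  moreover have "\<delta> ?n = \<delta> 0" using \<gamma>(1) by (simp add: \<delta>_def)
  ultimately show ?thesis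
    unfolding sectorial_decomposition_def using n s \<gamma>(2)
    by (intro exI[of _ "f \<circ> g"] exI[of _ s] exI[of _ \<delta>] exI[of _ \<sigma>] exI[of _ ?n]) blast
qed

end

section \<open>The normal form (the chart field with 2b = 1) and its explicit flow\<close>

definition normal_field :: "real \<times> real \<Rightarrow> real \<times> real" where
  "normal_field = (\<lambda>(u, v). (v - u\<^sup>2, - u * v))"

definition flow_denom :: "real \<times> real \<Rightarrow> real \<Rightarrow> real" where
  "flow_denom z t = 1 + fst z * t + snd z * t\<^sup>2 / 2"

definition normal_flow :: "real \<times> real \<Rightarrow> real \<Rightarrow> real \<times> real" where
  "normal_flow z t = ((fst z + snd z * t) / flow_denom z t, snd z / flow_denom z t)"

lemma normal_flow_0 [simp]: "normal_flow z 0 = z"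
  by (simp add: normal_flow_def flow_denom_def)

lemma solution_normal_flow:
  assumes "\<And>t. t \<in> I \<Longrightarrow> flow_denom z t \<noteq> 0"
  shows "solution_on normal_field (normal_flow z) I"
  unfolding solution_on_def
proof
  fix t assume "t \<in> I"
  obtain u v where z: "z = (u, v)" by fastforce
  define D where "D = flow_denom z t"
  have D: "D \<noteq> 0" using assms \<open>t \<in> I\<close> by (simp add: D_def)
  have D': "(flow_denom z has_real_derivative u + v * t) (at t within I)"
    unfolding flow_denom_def z by (auto intro!: derivative_eq_intros)
  \<comment> \<open>With D for \<open>flow_denom z\<close>, this is (D'/D)' = D''/D - (D'/D)^2,
    where D'' is the constant \<open>v\<close>.\<close>
  have d1: "((\<lambda>t. (u + v * t) / flow_denom z t) has_real_derivative
          v / D - ((u + v * t) / D)\<^sup>2) (at t within I)"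
    using D D_def
    by (auto intro!: derivative_eq_intros D' simp: field_simps power2_eq_square)
  have d2: "((\<lambda>t. v / flow_denom z t) has_real_derivative
          - ((u + v * t) / D) * (v / D)) (at t within I)"
    using D D_def
    by (auto intro!: derivative_eq_intros D' simp: field_simps power2_eq_square)
  have "((\<lambda>t. ((u + v * t) / flow_denom z t, v / flow_denom z t)) has_vector_derivative
      (v / D - ((u + v * t) / D)\<^sup>2, - ((u + v * t) / D) * (v / D))) (at t within I)"
    using d1 d2 by (intro has_vector_derivative_Pair)
      (simp_all add: has_real_derivative_iff_has_vector_derivative)
  then show "(normal_flow z has_vector_derivative normal_field (normal_flow z t)) (at t within I)"
    by (simp add: normal_flow_def[abs_def] normal_field_def z D_def)
qed

lemma norm_power2_pair: "(norm z)\<^sup>2 = (fst z)\<^sup>2 + (snd z)\<^sup>2" for z :: "real \<times> real"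
  by (cases z) (simp add: norm_Pair)

lemma mem_cball_2_iff: "z \<in> cball 0 2 \<longleftrightarrow> (fst z)\<^sup>2 + (snd z)\<^sup>2 \<le> 4" for z :: "real \<times> real"
  using abs_le_square_iff[of "norm z" 2] by (simp add: norm_power2_pair)

lemma mem_ball_2_iff: "z \<in> ball 0 2 \<longleftrightarrow> (fst z)\<^sup>2 + (snd z)\<^sup>2 < 4" for z :: "real \<times> real"
  using abs_le_square_iff[of 2 "norm z"] by (auto simp: norm_power2_pair)

text \<open>Since D'^2 - 2vD does not depend on time, the distance from the origin depends on time
  only through D. Leaving the disc of radius 2 thus becomes an inequality in the single number
  D.\<close>

lemma normal_flow_norm:
  assumes "flow_denom z t \<noteq> 0"
  shows "(fst (normal_flow z t))\<^sup>2 + (snd (normal_flow z t))\<^sup>2 =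
    ((fst z)\<^sup>2 + (snd z)\<^sup>2 + 2 * snd z * (flow_denom z t - 1)) / (flow_denom z t)\<^sup>2"
proof -
  have "(fst z + snd z * t)\<^sup>2 + (snd z)\<^sup>2 =
      (fst z)\<^sup>2 + (snd z)\<^sup>2 + 2 * snd z * (flow_denom z t - 1)"
    by (simp add: flow_denom_def power2_eq_square algebra_simps)
  then show ?thesis
    by (simp add: normal_flow_def power_divide add_divide_distrib[symmetric])
qed

text \<open>For v > 0 the denominator grows quadratically against a numerator that is at most
  linear. On the positive u-axis it grows linearly against a constant.\<close>

lemma normal_flow_tendsto:
  assumes "snd z > 0 \<or> snd z = 0 \<and> fst z > 0"
  shows "(normal_flow z \<longlongrightarrow> (0, 0)) at_top"
proof -
  obtain u v where z: "z = (u, v)" by fastforce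
  have "((\<lambda>t. (u + v * t) / (1 + u * t + v * t\<^sup>2 / 2)) \<longlongrightarrow> 0) at_top \<and>
      ((\<lambda>t. v / (1 + u * t + v * t\<^sup>2 / 2)) \<longlongrightarrow> 0) at_top"
  proof (cases "v > 0")
    case True
    then show ?thesis by (intro conjI; real_asymp)
  next
    case False
    with assms z have "v = 0" "u > 0" by auto
    then show ?thesis by simp real_asymp
  qed
  then show ?thesis
    unfolding normal_flow_def[abs_def] flow_denom_def z by (auto intro!: tendsto_Pair)
qed

text \<open>The level set of \<open>h\<close> at \<open>e\<close> is compact and so has an earliest
  time. Applied to the denominator with e > 0, this stops the flow before the blow-up, while the
  solution still exists on the whole interval.\<close>

lemma first_crossing:
  fixes h :: "real \<Rightarrow> real"
  assumes "0 \<le> b" "continuous_on {0..b} h" "e < h 0" "h b \<le> e"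
  obtains T where "0 < T" "T \<le> b" "h T = e" "\<And>t. 0 \<le> t \<Longrightarrow> t \<le> T \<Longrightarrow> e \<le> h t"
proof -
  let ?K = "{t \<in> {0..b}. h t = e}"
  have "?K \<noteq> {}"
    using IVT2'[of h b e 0] assms by auto
  moreover have "compact ?K"
    using continuous_closed_preimage_constant[OF assms(2), of e]
      bounded_subset[OF bounded_closed_interval, of ?K 0 b]
    unfolding compact_eq_bounded_closed by fastforce
  ultimately obtain T where T: "T \<in> ?K" "\<And>t. t \<in> ?K \<Longrightarrow> T \<le> t"
    using compact_attains_inf[of ?K] by blast
  \<comment> \<open>A value below \<open>e\<close> at \<open>t\<close> would force a crossing at
    some s \<le> t. Minimality of \<open>T\<close> leaves only s = t, where \<open>h\<close> equals
    \<open>e\<close> after all.\<close>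
  have "e \<le> h t" if t: "0 \<le> t" "t \<le> T" for t
  proof (rule ccontr)
    assume "\<not> e \<le> h t"
    moreover have "continuous_on {0..t} h"
      using assms(2) by (rule continuous_on_subset) (use T t in auto)
    ultimately obtain s where "0 \<le> s" "s \<le> t" "h s = e"
      using IVT2'[of h t e 0] assms t by auto
    moreover from this T t have "T \<le> s" by auto
    ultimately have "s = t" using t by linarith
    with \<open>h s = e\<close> \<open>\<not> e \<le> h t\<close> show False by simp
  qed
  moreover have "0 < T" using T assms(3) by (cases "T = 0") auto
  ultimately show ?thesis using that T by auto
qed

text \<open>By \<open>normal_flow_norm\<close>, the third hypothesis says that the squared norm at
  time \<open>T\<close> exceeds 4, cleared of its denominator.\<close>

lemma normal_flow_leaves:
  assumes "0 < T" "\<And>t. 0 \<le> t \<Longrightarrow> t \<le> T \<Longrightarrow> 0 < flow_denom z t"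
    and "4 * (flow_denom z T)\<^sup>2 < (fst z)\<^sup>2 + (snd z)\<^sup>2 + 2 * snd z * (flow_denom z T - 1)"
    and "S \<subseteq> cball 0 2"
  shows "leaves normal_field S z"
proof -
  have "0 < flow_denom z T" using assms by simp
  then have "4 < (fst (normal_flow z T))\<^sup>2 + (snd (normal_flow z T))\<^sup>2"
    using assms(3) by (simp add: normal_flow_norm less_divide_eq)
  then have "normal_flow z T \<notin> S" using assms(4) mem_cball_2_iff[of "normal_flow z T"] by auto
  moreover have "solution_on normal_field (normal_flow z) {0..T}"
    by (rule solution_normal_flow) (use assms(2) in force)
  ultimately show ?thesis
    unfolding leaves_def using assms(1) by (intro exI[of _ "normal_flow z"] exI[of _ T]) auto
qed

text \<open>D falls from 1 to a nonpositive value, so it takes the value \<open>e\<close> on the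
  way. The inequality assumed for \<open>e\<close> then places the orbit outside the disc at that
  moment.\<close>

lemma normal_flow_blow_up_leaves:
  assumes "0 \<le> b" "flow_denom z b \<le> 0" "0 < e" "e < 1"
    and "4 * e\<^sup>2 < (fst z)\<^sup>2 + (snd z)\<^sup>2 + 2 * snd z * (e - 1)"
    and "S \<subseteq> cball 0 2"
  shows "leaves normal_field S z"
proof -
  have "continuous_on {0..b} (flow_denom z)"
    unfolding flow_denom_def[abs_def] by (intro continuous_intros) auto
  moreover have "e < flow_denom z 0" using assms by (simp add: flow_denom_def)
  moreover have "flow_denom z b \<le> e" using assms by simp
  ultimately obtain T where "0 < T" "flow_denom z T = e"
    "\<And>t. 0 \<le> t \<Longrightarrow> t \<le> T \<Longrightarrow> e \<le> flow_denom z t"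
    using first_crossing assms(1) by metis
  then show ?thesis
    using assms by (intro normal_flow_leaves[of T]) (auto intro: less_le_trans)
qed

section \<open>Orbits in the upper half disc (a = 1) and the lower half disc (a = -1)\<close>

definition half_disc :: "real \<Rightarrow> (real \<times> real) set" where
  "half_disc a = cball 0 2 \<inter> {z. 0 \<le> a * snd z}"

lemma mem_half_disc_iff:
  "z \<in> half_disc a \<longleftrightarrow> (fst z)\<^sup>2 + (snd z)\<^sup>2 \<le> 4 \<and> 0 \<le> a * snd z"
  using mem_cball_2_iff[of z] by (auto simp: half_disc_def)

text \<open>For v < 0 the denominator is a parabola opening downwards, so it vanishes at some
  positive time whatever the sign of \<open>u\<close>.\<close>

lemma lower_half_disc_leaves:
  assumes "snd z < 0" shows "leaves normal_field (half_disc (-1)) z"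
proof -
  obtain u v where z: "z = (u, v)" by fastforce
  \<comment> \<open>Chosen so that b * (-v) is at least 2 (1 + |u|). With b \<ge> 1, the quadratic
    term of D then outweighs 1 + u b.\<close>
  define b where "b = 1 + 2 * (1 + \<bar>u\<bar>) / (- v)"
  \<comment> \<open>The bound 1/2 gives both 4 e^2 \<le> 2 e and 2 v (e - 1) \<ge> -v; the bound
    -v/4 gives 2 e < -v.\<close>
  define e where "e = min (1/2) (- v / 4)"
  have v: "v < 0" using assms z by simp
  have b: "1 \<le> b" using v by (simp add: b_def divide_nonneg_neg)
  have "2 * (1 + \<bar>u\<bar>) = (b - 1) * (- v)" using v by (simp add: b_def)
  then have "2 * (1 + \<bar>u\<bar>) \<le> b * (- v)" using v by (simp add: algebra_simps)
  then have "b * (2 * (1 + \<bar>u\<bar>)) \<le> b * (b * (- v))" using b by (intro mult_left_mono) auto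
  moreover have "u * b \<le> \<bar>u\<bar> * b" using b by (intro mult_right_mono) auto
  ultimately have "flow_denom z b \<le> 0"
    using b unfolding flow_denom_def z fst_conv snd_conv power2_eq_square
    by (simp only: algebra_simps)
  moreover have e: "0 < e" "e \<le> 1/2" "e \<le> - v / 4" using v by (auto simp: e_def)
  moreover have "4 * e\<^sup>2 < u\<^sup>2 + v\<^sup>2 + 2 * v * (e - 1)"
  proof -
    have "4 * e\<^sup>2 \<le> 2 * e" using e by (simp add: power2_eq_square)
    also have "\<dots> < - v" using e by linarith
    also have "\<dots> \<le> 2 * v * (e - 1)"
      using mult_left_mono_neg[of "e - 1" "- (1/2)" "2 * v"] e v by simp
    finally show ?thesis using zero_le_power2[of u] zero_le_power2[of v] by linarith
  qed
  ultimately show ?thesis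
    using b by (intro normal_flow_blow_up_leaves[of b z e]) (auto simp: half_disc_def z)
qed

text \<open>The last hypothesis places the point outside the disc \<open>cball (0, 1) 1\<close>. If
  u^2 < 2v, the orbit is a complete ellipse whose top lies above height 2; otherwise D vanishes at a
  positive time and the orbit blows up.\<close>

lemma upper_half_disc_leaves:
  assumes "0 \<le> snd z" "fst z < 0" "2 * snd z < (fst z)\<^sup>2 + (snd z)\<^sup>2"
  shows "leaves normal_field (half_disc 1) z"
proof -
  obtain u v where z: "z = (u, v)" by fastforce
  show ?thesis
  proof (cases "u\<^sup>2 < 2 * v")
    case True
    then have v: "0 < v" using zero_le_power2[of u] by linarith
    \<comment> \<open>Completing the square shows that D has no real zero in this case.\<close>
    have sq: "2 * v * flow_denom z t = (u + v * t)\<^sup>2 + (2 * v - u\<^sup>2)" for t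
      by (simp add: flow_denom_def z power2_eq_square algebra_simps)
    have pos: "0 < flow_denom z t" for t
      using sq[of t] True v zero_le_power2[of "u + v * t"]
      by (metis add_nonneg_pos diff_gt_0_iff_gt mult_pos_pos zero_less_mult_pos zero_less_numeral)
    \<comment> \<open>The time -u/v is positive and minimises D. There the orbit meets the v-axis at
      height v/D, its maximum.\<close>
    define D where "D = flow_denom z (- u / v)"
    have D: "2 * v * D = 2 * v - u\<^sup>2" using sq[of "- u / v"] v by (simp add: D_def)
    have "v * (2 * D) < v * v" using D assms(3) z by (simp add: power2_eq_square)
    then have "2 * D < v" using v by simp
    then have "4 * D\<^sup>2 < v\<^sup>2"
      using power_strict_mono[of "2 * D" v 2] pos[of "- u / v"]
      by (simp add: power_mult_distrib D_def)
    also have "v\<^sup>2 = u\<^sup>2 + v\<^sup>2 + 2 * v * (D - 1)" using D by (simp add: algebra_simps)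
    finally show ?thesis
      using pos v assms z unfolding D_def
      by (intro normal_flow_leaves[of "- u / v"]) (auto simp: half_disc_def divide_neg_pos less_imp_le)
  next
    case False
    \<comment> \<open>This is the limit, as D tends to 0, of the numerator in
      \<open>normal_flow_norm\<close>. The choice of \<open>e\<close> makes 4 e^2 smaller than
      \<open>m\<close>.\<close>
    define m where "m = u\<^sup>2 + v\<^sup>2 - 2 * v"
    define e where "e = min (1/2) (m / 4)"
    have m: "0 < m" using assms(3) z by (simp add: m_def)
    have e: "0 < e" "e \<le> 1/2" "e \<le> m / 4" using m by (auto simp: e_def)
    \<comment> \<open>On the u-axis D is linear with a zero at -1/u. Off it, the minimum of D, taken
      at -u/v, is 1 - u^2/(2v) \<le> 0.\<close>
    obtain b where b: "0 \<le> b" "flow_denom z b \<le> 0"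
    proof (cases "v = 0")
      case True
      then have "flow_denom z (- 1 / u) \<le> 0" using assms z by (simp add: flow_denom_def)
      with that[of "- 1 / u"] assms z show ?thesis by simp
    next
      case v: False
      then have v: "0 < v" using assms z by simp
      then have "flow_denom z (- u / v) = 1 - u\<^sup>2 / (2 * v)"
        by (simp add: flow_denom_def z power2_eq_square field_simps)
      also have "\<dots> \<le> 0" using False v by simp
      finally show ?thesis using that[of "- u / v"] assms z v by (simp add: divide_nonpos_pos)
    qed
    have "4 * e\<^sup>2 \<le> 2 * e" using e by (simp add: power2_eq_square)
    also have "\<dots> < m" using e by linarith
    also have "m \<le> u\<^sup>2 + v\<^sup>2 + 2 * v * (e - 1)"
      using e assms z by (simp add: m_def algebra_simps)
    finally show ?thesis
      using e b by (intro normal_flow_blow_up_leaves[of b z e]) (auto simp: half_disc_def z)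
  qed
qed

text \<open>In the closed first quadrant D \<ge> 1 at all forward times. Since v \<le> 2, the
  numerator of the squared norm is at most 4 + 4 (D - 1) = 4D \<le> 4 D^2, so the disc is never
  left.\<close>

lemma upper_half_disc_tends_in_quadrant:
  assumes "z \<in> half_disc 1" "0 \<le> fst z" "z \<noteq> (0, 0)"
  shows "tends_in normal_field (half_disc 1) (0, 0) z"
proof -
  obtain u v where z: "z = (u, v)" by fastforce
  have uv: "0 \<le> u" "0 \<le> v" "u\<^sup>2 + v\<^sup>2 \<le> 4" "v \<noteq> 0 \<or> u \<noteq> 0"
    using assms by (auto simp: mem_half_disc_iff z)
  then have v2: "v \<le> 2"
    using power2_le_imp_le[of v 2] zero_le_power2[of u] by simp
  have D1: "1 \<le> flow_denom z t" if "0 \<le> t" for t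
    using that uv by (simp add: flow_denom_def z)
  have "normal_flow z t \<in> half_disc 1" if t: "0 \<le> t" for t
  proof -
    define D where "D = flow_denom z t"
    have D: "1 \<le> D" using D1[OF t] by (simp add: D_def)
    have "u\<^sup>2 + v\<^sup>2 + 2 * v * (D - 1) \<le> 4 + 4 * (D - 1)"
      using uv v2 D by (intro add_mono mult_right_mono) auto
    also have "\<dots> \<le> 4 * D\<^sup>2"
      using D by (simp add: power2_eq_square)
    finally have "(u\<^sup>2 + v\<^sup>2 + 2 * v * (D - 1)) / D\<^sup>2 \<le> 4"
      using D by (simp add: divide_le_eq)
    moreover have "0 \<le> snd (normal_flow z t)"
      using D uv by (simp add: normal_flow_def z D_def)
    ultimately show ?thesis
      using normal_flow_norm[of z t] D
      by (simp add: mem_half_disc_iff D_def z)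
  qed
  moreover have "solution_on normal_field (normal_flow z) {0..}"
    by (rule solution_normal_flow) (use D1 in force)
  moreover have "(normal_flow z \<longlongrightarrow> (0, 0)) at_top"
    using uv z by (intro normal_flow_tendsto) auto
  ultimately show ?thesis
    unfolding tends_in_def by (intro exI[of _ "normal_flow z"]) auto
qed

text \<open>Completing the square. The boundary of this disc is the orbit through (0, 2) together
  with the origin; it touches the circle of radius 2 at (0, 2).\<close>

lemma mem_elliptic_disc_iff: "z \<in> cball (0, 1) 1 \<longleftrightarrow> (fst z)\<^sup>2 + (snd z)\<^sup>2 \<le> 2 * snd z"
  for z :: "real \<times> real"
proof -
  have "z \<in> cball (0, 1) 1 \<longleftrightarrow> (norm ((0, 1) - z))\<^sup>2 \<le> 1"
    using abs_le_square_iff[of "norm ((0, 1) - z)" 1] by (simp add: dist_norm)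
  also have "(norm ((0, 1) - z))\<^sup>2 = (fst z)\<^sup>2 + (snd z)\<^sup>2 - 2 * snd z + 1"
    unfolding norm_power2_pair by (simp add: power2_eq_square algebra_simps)
  finally show ?thesis by auto
qed

lemma elliptic_disc_subset: "cball (0, 1) 1 \<subseteq> half_disc 1"
proof
  fix z :: "real \<times> real" assume "z \<in> cball (0, 1) 1"
  then have z: "(fst z)\<^sup>2 + (snd z)\<^sup>2 \<le> 2 * snd z" by (simp only: mem_elliptic_disc_iff)
  then have v: "0 \<le> snd z" using zero_le_power2[of "fst z"] zero_le_power2[of "snd z"] by linarith
  moreover have "(snd z)\<^sup>2 \<le> 2 * snd z" using z zero_le_power2[of "fst z"] by linarith
  then have "snd z \<le> 2" using v by (cases "snd z = 0") (auto simp: power2_eq_square)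
  ultimately show "z \<in> half_disc 1"
    using z by (simp add: mem_half_disc_iff)
qed

text \<open>The small disc is invariant: u^2 + v^2 \<le> 2v bounds the numerator of the squared norm
  by 2vD, and division by D^2 gives the same inequality at the moved point, whose second coordinate
  is v/D.\<close>

lemma elliptic_disc_tends_in:
  assumes "z \<in> cball (0, 1) 1 - {(0, 0)}"
  shows "tends_in normal_field (half_disc 1) (0, 0) z"
proof -
  obtain u v where z: "z = (u, v)" by fastforce
  have uv: "u\<^sup>2 + v\<^sup>2 \<le> 2 * v" "v \<noteq> 0 \<or> u \<noteq> 0"
    using assms z by (auto simp: mem_elliptic_disc_iff simp del: mem_cball)
  have v: "0 < v"
  proof -
    have "v \<noteq> 0" using uv by auto
    moreover have "0 \<le> v" using uv(1) zero_le_power2[of u] zero_le_power2[of v] by linarith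
    ultimately show ?thesis by simp
  qed
  have "u\<^sup>2 < 2 * v" using uv v zero_less_power2[of v] by linarith
  have pos: "0 < flow_denom z t" for t
  proof -
    have "2 * v * flow_denom z t = (u + v * t)\<^sup>2 + (2 * v - u\<^sup>2)"
      by (simp add: flow_denom_def z power2_eq_square algebra_simps)
    also have "\<dots> > 0" using \<open>u\<^sup>2 < 2 * v\<close> by (intro add_nonneg_pos) auto
    finally show ?thesis using v by (simp add: zero_less_mult_iff)
  qed
  have "normal_flow z t \<in> half_disc 1" for t
  proof -
    define D where "D = flow_denom z t"
    have D: "0 < D" using pos by (simp add: D_def)
    have "(u\<^sup>2 + v\<^sup>2 + 2 * v * (D - 1)) / D\<^sup>2 \<le> 2 * v * D / D\<^sup>2"
      using uv by (intro divide_right_mono) (auto simp: algebra_simps)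
    also have "\<dots> = 2 * (v / D)" using D by (simp add: power2_eq_square)
    finally have "normal_flow z t \<in> cball (0, 1) 1"
      using normal_flow_norm[of z t] D
      by (simp add: mem_elliptic_disc_iff D_def z normal_flow_def del: mem_cball)
    then show ?thesis using elliptic_disc_subset by blast
  qed
  moreover have "solution_on normal_field (normal_flow z) {0..}"
    by (rule solution_normal_flow) (use pos in \<open>simp add: less_imp_neq[symmetric]\<close>)
  moreover have "(normal_flow z \<longlongrightarrow> (0, 0)) at_top"
    using v z by (intro normal_flow_tendsto) auto
  ultimately show ?thesis
    unfolding tends_in_def by (intro exI[of _ "normal_flow z"]) auto
qed

section \<open>The circle of radius 2 and its two halves\<close>

text \<open>The curve starts at (2, 0), so that the parameters 0, 1/2 and 1 are exactly its meetings
  with the u-axis, where it will be cut.\<close>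

definition circle :: "real \<Rightarrow> real \<times> real" where
  "circle x = (2 * cos (2 * pi * x), 2 * sin (2 * pi * x))"

lemma simple_path_circle: "simple_path circle"
  unfolding simple_path_def loop_free_def
proof (intro conjI ballI impI)
  show "path circle"
    unfolding path_def circle_def[abs_def] by (intro continuous_intros)
  fix x y :: real assume xy: "x \<in> {0..1}" "y \<in> {0..1}" and "circle x = circle y"
  then have "sin (2 * pi * x) = sin (2 * pi * y) \<and> cos (2 * pi * x) = cos (2 * pi * y)"
    by (simp add: circle_def)
  then obtain n :: int where "2 * pi * x = 2 * pi * y + 2 * pi * n"
    using sin_cos_eq_iff by blast
  then have "2 * pi * x = 2 * pi * (y + n)" by (simp add: algebra_simps)
  then have n: "x = y + n" by simp
  \<comment> \<open>Equal angles differ by \<open>n\<close> full turns. The values 1 and -1 are the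
    permitted coincidence of the two end points.\<close>
  then have "\<bar>real_of_int n\<bar> \<le> 1" using xy by auto
  then have "n = 0 \<or> n = 1 \<or> n = -1" by linarith
  then show "x = y \<or> x = 0 \<and> y = 1 \<or> x = 1 \<and> y = 0" using n xy by auto
qed

definition half_circle :: "real \<Rightarrow> (real \<times> real) set" where
  "half_circle a = {z. (fst z)\<^sup>2 + (snd z)\<^sup>2 = 4 \<and> 0 \<le> a * snd z}"

definition horizontal_diameter :: "(real \<times> real) set" where
  "horizontal_diameter = {z. \<bar>fst z\<bar> \<le> 2 \<and> snd z = 0}"

lemma circle_upper_image: "circle ` {0..1/2} = half_circle 1"
proof (intro equalityI subsetI)
  fix z assume "z \<in> half_circle 1"
  then have "0 \<le> snd z / 2" "(fst z / 2)\<^sup>2 + (snd z / 2)\<^sup>2 = 1"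
    by (auto simp: half_circle_def power_divide)
  then obtain t where t: "0 \<le> t" "t \<le> pi" "fst z / 2 = cos t" "snd z / 2 = sin t"
    using sincos_total_pi by metis
  then have "z = circle (t / (2 * pi))" by (cases z) (simp add: circle_def)
  moreover have "t / (2 * pi) \<in> {0..1/2}" using t by (simp add: field_simps)
  ultimately show "z \<in> circle ` {0..1/2}" by blast
next
  fix z assume "z \<in> circle ` {0..1/2}"
  then obtain x where x: "0 \<le> x" "x \<le> 1/2" "z = circle x" by auto
  have "(2 * cos (2 * pi * x))\<^sup>2 + (2 * sin (2 * pi * x))\<^sup>2 = 4"
    unfolding power_mult_distrib using sin_cos_squared_add[of "2 * pi * x"]
    by (simp only: power2_eq_square[of "2 :: real"])
  moreover have "0 \<le> sin (2 * pi * x)"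
    using x by (intro sin_ge_zero) auto
  ultimately show "z \<in> half_circle 1" using x by (simp add: half_circle_def circle_def)
qed

lemma circle_lower_image: "circle ` {1/2..1} = half_circle (-1)"
proof -
  have shift: "circle (x + 1/2) = - circle x" for x
  proof -
    have "2 * pi * (x + 1/2) = 2 * pi * x + pi" by (simp add: algebra_simps)
    then show ?thesis by (simp add: circle_def)
  qed
  have "{1/2..1} = (\<lambda>x. x + 1/2) ` {0..1/2 :: real}"
    by (simp add: image_add_atLeastAtMost')
  then have "circle ` {1/2..1} = uminus ` circle ` {0..1/2}"
    by (simp only: image_image shift)
  also have "\<dots> = half_circle (-1)"
  proof (intro equalityI subsetI)
    fix z assume "z \<in> half_circle (-1)"
    then have "- z \<in> half_circle 1" by (simp add: half_circle_def)
    then show "z \<in> uminus ` circle ` {0..1/2}"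
      unfolding circle_upper_image by (intro image_eqI[of _ _ "- z"]) auto
  qed (auto simp: circle_upper_image half_circle_def)
  finally show ?thesis .
qed

lemma mem_sphere_2_iff: "z \<in> sphere 0 2 \<longleftrightarrow> (fst z)\<^sup>2 + (snd z)\<^sup>2 = 4" for z :: "real \<times> real"
  using mem_cball_2_iff[of z] mem_ball_2_iff[of z] by auto

lemma path_image_circle: "path_image circle = sphere 0 2"
proof -
  have "{0..1} = {0..1/2} \<union> {1/2..1 :: real}" by auto
  then have "path_image circle = half_circle 1 \<union> half_circle (-1)"
    unfolding path_image_def circle_upper_image[symmetric] circle_lower_image[symmetric]
    by (simp only: image_Un)
  also have "\<dots> = sphere 0 2"
    unfolding set_eq_iff mem_sphere_2_iff by (auto simp: half_circle_def)
  finally show ?thesis .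
qed

lemma inside_sphere: "inside (sphere (0 :: real \<times> real) 2) = ball 0 2"
  using inside_frontier_eq_interior[of "cball (0 :: real \<times> real) 2"] by simp

lemma closed_disc_sphere: "closed_disc (sphere z r) = cball z r" if "r \<noteq> 0" for z :: "real \<times> real"
  using closed_disc_frontier[of "cball z r"] that by (simp add: frontier_cball)

text \<open>A half disc is compact and convex, as the intersection of a disc with a half plane, so
  it suffices to compute its frontier. The sign of \<open>a\<close> selects the half.\<close>

lemma closed_disc_half_disc:
  assumes "a \<noteq> 0" shows "closed_disc (horizontal_diameter \<union> half_circle a) = half_disc a"
proof -
  have half: "{z :: real \<times> real. 0 \<le> a * snd z} = {z. (0, a) \<bullet> z \<ge> 0}"
    by auto
  have "closed (half_disc a)" "convex (half_disc a)"
    unfolding half_disc_def half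
    by (simp_all add: closed_Int closed_halfspace_ge convex_Int convex_halfspace_ge)
  have "bounded (half_disc a)"
    unfolding half_disc_def by (simp add: bounded_Int)
  have "interior (half_disc a) = ball 0 2 \<inter> {z. 0 < a * snd z}"
  proof -
    have "(0 :: real, a) \<noteq> 0" using assms by (simp add: zero_prod_def)
    from interior_halfspace_ge[OF this, of 0] show ?thesis
      unfolding half_disc_def half interior_Int interior_cball by (auto simp: inner_prod_def)
  qed
  then have "frontier (half_disc a) = half_disc a - ball 0 2 \<inter> {z. 0 < a * snd z}"
    using \<open>closed (half_disc a)\<close> by (simp add: frontier_def)
  also have "\<dots> = horizontal_diameter \<union> half_circle a"
  proof (rule set_eqI)
    fix z :: "real \<times> real"
    have "snd z = 0 \<Longrightarrow> \<bar>fst z\<bar> \<le> 2 \<longleftrightarrow> (fst z)\<^sup>2 + (snd z)\<^sup>2 \<le> 4"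
      using abs_le_square_iff[of "fst z" 2] by simp
    then show "z \<in> half_disc a - ball 0 2 \<inter> {z. 0 < a * snd z} \<longleftrightarrow> z \<in> horizontal_diameter \<union> half_circle a"
      using assms unfolding Diff_iff Int_iff Un_iff mem_half_disc_iff mem_ball_2_iff
      by (auto simp: horizontal_diameter_def half_circle_def zero_less_mult_iff zero_le_mult_iff)
  qed
  finally show ?thesis
    using closed_disc_frontier[of "half_disc a"] \<open>closed _\<close> \<open>convex _\<close> \<open>bounded _\<close>
    by (simp add: compact_eq_bounded_closed)
qed

section \<open>Time-reversing symmetry in the v-axis\<close>

definition reflection :: "real \<times> real \<Rightarrow> real \<times> real" where
  "reflection z = (- fst z, snd z)"

lemma reflection_simps [simp]:
  "fst (reflection z) = - fst z" "snd (reflection z) = snd z" "reflection (reflection z) = z"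
  "reflection (0, 0) = (0, 0)"
  by (simp_all add: reflection_def)

lemma reflection_image_eqI:
  assumes "\<And>z. z \<in> S \<Longrightarrow> reflection z \<in> S" shows "reflection ` S = S"
  using assms by (force intro: image_eqI[of _ _ "reflection z" for z])

lemma reflection_half_disc: "reflection ` half_disc a = half_disc a"
  by (rule reflection_image_eqI) (simp add: mem_half_disc_iff)

text \<open>The normal form is reversible: reflection in the v-axis turns it into its own time
  reversal. Backward behaviour at a point is therefore forward behaviour at its mirror
  image.\<close>

interpretation reflection: field_conjugacy reflection 1 normal_field "reversed normal_field"
proof (rule field_conjugacy.intro)
  show "linear reflection" by (rule linearI) (simp_all add: reflection_def)
  show "bij reflection" by (rule o_bij[of reflection]) (auto simp: o_def)
qed (auto simp: reversed_def normal_field_def reflection_def)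

lemma reversed_tends_in_upper:
  assumes "tends_in normal_field (half_disc 1) (0, 0) (reflection z)"
  shows "tends_in (reversed normal_field) (half_disc 1) (0, 0) z"
  using reflection.tends_in_image[OF assms] by (simp add: reflection_half_disc)

lemma reversed_leaves_half_disc:
  assumes "leaves normal_field (half_disc a) (reflection z)"
  shows "leaves (reversed normal_field) (half_disc a) z"
  using reflection.leaves_image[OF assms] by (simp add: reflection_half_disc)

section \<open>The two sectors of the normal form\<close>

lemma hyperbolic_sector_lower: "hyperbolic_sector normal_field (half_disc (-1)) horizontal_diameter"
  unfolding hyperbolic_sector_def
proof
  fix z assume z: "z \<in> half_disc (-1) - horizontal_diameter"
  then have "(fst z)\<^sup>2 + (snd z)\<^sup>2 \<le> 4" "snd z \<le> 0" by (auto simp: mem_half_disc_iff)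
  moreover have "\<bar>fst z\<bar> \<le> 2"
    using abs_le_square_iff[of "fst z" 2] calculation(1) zero_le_power2[of "snd z"] by simp
  ultimately have "snd z < 0" using z by (auto simp: horizontal_diameter_def)
  then show "leaves normal_field (half_disc (-1)) z \<and>
      leaves (reversed normal_field) (half_disc (-1)) z"
    by (simp add: lower_half_disc_leaves reversed_leaves_half_disc)
qed

lemma elliptic_sector_upper: "elliptic_sector normal_field (0, 0) (half_disc 1)"
proof -
  \<comment> \<open>The orbit through (0, 2), which is the rational parametrisation of the unit
    circle about (0, 1) with the origin missing.\<close>
  let ?\<gamma> = "\<lambda>t::real. (2 * t / (1 + t\<^sup>2), 2 / (1 + t\<^sup>2))" and ?D = "cball (0 :: real, 1 :: real) 1"
  have pos: "0 < 1 + t\<^sup>2" for t :: real by (rule add_pos_nonneg) auto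
  have \<gamma>: "?\<gamma> = normal_flow (0, 2)"
    by (rule ext) (simp add: normal_flow_def flow_denom_def)
  have "solution_on normal_field ?\<gamma> UNIV"
    unfolding \<gamma> by (rule solution_normal_flow) (use pos in \<open>simp add: flow_denom_def less_imp_neq[symmetric]\<close>)
  moreover have range: "insert (0, 0) (range ?\<gamma>) = sphere (0, 1) 1"
  proof (rule set_eqI)
    fix z :: "real \<times> real"
    obtain u v where z: "z = (u, v)" by fastforce
    have "z \<in> sphere (0, 1) 1 \<longleftrightarrow> sqrt (u\<^sup>2 + (1 - v)\<^sup>2) = 1"
      by (simp add: z dist_norm norm_Pair)
    also have "\<dots> \<longleftrightarrow> u\<^sup>2 + v\<^sup>2 = 2 * v"
      by (simp add: real_sqrt_eq_1_iff power2_eq_square algebra_simps)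
    finally have sphere: "z \<in> sphere (0, 1) 1 \<longleftrightarrow> u\<^sup>2 + v\<^sup>2 = 2 * v" .
    have "z \<in> range ?\<gamma>" if "u\<^sup>2 + v\<^sup>2 = 2 * v" "v \<noteq> 0"
    proof -
      \<comment> \<open>Along this orbit the quotient of the coordinates is the time, so a point of
        the circle other than the origin is reached at time u/v.\<close>
      have "1 + (u / v)\<^sup>2 = 2 / v"
        using that by (simp add: field_simps power2_eq_square)
      then have "?\<gamma> (u / v) = z" using that by (simp add: z)
      then show ?thesis by (rule range_eqI[OF sym])
    qed
    moreover have "u\<^sup>2 + v\<^sup>2 = 2 * v" if mem: "z \<in> range ?\<gamma>"
    proof -
      obtain t where t: "u = 2 * t / (1 + t\<^sup>2)" "v = 2 / (1 + t\<^sup>2)" using mem z by auto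
      define w where "w = 1 + t\<^sup>2"
      have "u\<^sup>2 + v\<^sup>2 = 4 * w / w\<^sup>2"
        unfolding t w_def[symmetric] power_divide add_divide_distrib[symmetric]
        by (simp add: w_def power_mult_distrib)
      then show ?thesis
        using pos[of t] unfolding t(2) w_def[symmetric] by (simp add: power2_eq_square)
    qed
    ultimately show "z \<in> insert (0, 0) (range ?\<gamma>) \<longleftrightarrow> z \<in> sphere (0, 1) 1"
      unfolding sphere using z by (cases "v = 0") auto
  qed
  moreover have D: "closed_disc (insert (0, 0) (range ?\<gamma>)) = ?D"
    unfolding range by (rule closed_disc_sphere) simp
  moreover have "range ?\<gamma> \<subseteq> half_disc 1 - {(0, 0)}"
  proof -
    have "range ?\<gamma> \<subseteq> sphere (0, 1) 1" using range by blast
    moreover have "sphere (0, 1) 1 \<subseteq> half_disc 1"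
      using elliptic_disc_subset sphere_cball[of "(0, 1)" 1] by blast
    moreover have "(0, 0) \<notin> range ?\<gamma>" using pos by (auto simp: less_imp_neq[symmetric])
    ultimately show ?thesis by blast
  qed
  moreover have "(?\<gamma> \<longlongrightarrow> (0, 0)) at_top" "(?\<gamma> \<longlongrightarrow> (0, 0)) at_bot"
    by (intro tendsto_Pair; real_asymp)+
  moreover have "\<forall>q\<in>?D - {(0, 0)}. tends_in normal_field (half_disc 1) (0, 0) q \<and>
      tends_in (reversed normal_field) (half_disc 1) (0, 0) q"
  proof
    fix q assume q: "q \<in> ?D - {(0, 0)}"
    then have "reflection q \<in> ?D - {(0, 0)}"
      unfolding Diff_iff mem_elliptic_disc_iff by (auto simp: prod_eq_iff)
    with q show "tends_in normal_field (half_disc 1) (0, 0) q \<and>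
        tends_in (reversed normal_field) (half_disc 1) (0, 0) q"
      by (meson elliptic_disc_tends_in reversed_tends_in_upper)
  qed
  moreover have "\<forall>q\<in>half_disc 1 - ?D.
      tends_in normal_field (half_disc 1) (0, 0) q \<and> leaves (reversed normal_field) (half_disc 1) q \<or>
      leaves normal_field (half_disc 1) q \<and> tends_in (reversed normal_field) (half_disc 1) (0, 0) q"
  proof
    fix q assume "q \<in> half_disc 1 - ?D"
    then have q: "q \<in> half_disc 1" "(fst q)\<^sup>2 + (snd q)\<^sup>2 \<le> 4" "0 \<le> snd q"
      "2 * snd q < (fst q)\<^sup>2 + (snd q)\<^sup>2"
      unfolding Diff_iff mem_elliptic_disc_iff by (auto simp: mem_half_disc_iff)
    \<comment> \<open>Points of the half disc on the v-axis have height at most 2 and so lie in the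
      small disc. Hence \<open>q\<close> is off the axis, and the sign of \<open>fst q\<close>
      decides in which time direction it tends to the origin.\<close>
    have "fst q \<noteq> 0"
    proof
      assume "fst q = 0"
      then have "snd q \<le> 2" "2 * snd q < snd q * snd q"
        using q power2_le_imp_le[of "snd q" 2] by (simp_all add: power2_eq_square)
      then show False using q(3) mult_right_mono[of "snd q" 2 "snd q"] by simp
    qed
    moreover have "reflection q \<in> half_disc 1" using q(1) by (simp add: mem_half_disc_iff)
    moreover have "q \<noteq> (0, 0)" "reflection q \<noteq> (0, 0)" using \<open>fst q \<noteq> 0\<close> by (auto simp: reflection_def)
    ultimately show "tends_in normal_field (half_disc 1) (0, 0) q \<and> leaves (reversed normal_field) (half_disc 1) q \<or>
      leaves normal_field (half_disc 1) q \<and> tends_in (reversed normal_field) (half_disc 1) (0, 0) q"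
      using q upper_half_disc_tends_in_quadrant[of q] upper_half_disc_tends_in_quadrant[of "reflection q"]
        upper_half_disc_leaves[of q] upper_half_disc_leaves[of "reflection q"]
        reversed_tends_in_upper[of q] reversed_leaves_half_disc[of 1 q]
      by (cases "fst q < 0") auto
  qed
  ultimately show ?thesis
    unfolding elliptic_sector_def using elliptic_disc_subset
    by (intro exI[of _ ?\<gamma>] exI[of _ ?D]) simp
qed

lemma axis_orbit: "normal_flow (2, 0) t = (2 / (1 + 2 * t), 0)"
  by (simp add: normal_flow_def flow_denom_def)

lemma characteristic_axis_orbit:
  "characteristic_orbit normal_field (0, 0) (sphere 0 2) (normal_flow (2, 0))"
  unfolding characteristic_orbit_def
\<comment> \<open>The orbit 2 / (1 + 2t) on the axis blows up backwards at t = -1/2. Stopping at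
  -1/4 keeps the denominator positive, and the first coordinate exceeds 2 for negative
  times.\<close>
proof (intro conjI exI[of _ "1/4 :: real"] allI impI ballI)
  show "solution_on normal_field (normal_flow (2, 0)) {- (1/4)..}"
    by (rule solution_normal_flow) (simp add: flow_denom_def)
  fix t :: real assume "t \<in> {- (1/4)..<0}"
  then show "normal_flow (2, 0) t \<notin> closed_disc (sphere 0 2)"
    by (simp add: closed_disc_sphere axis_orbit not_le less_divide_eq)
next
  fix t :: real assume "0 < t"
  then show "normal_flow (2, 0) t \<in> inside (sphere 0 2)"
    by (simp add: inside_sphere axis_orbit divide_less_eq)
qed (simp_all add: normal_flow_tendsto)

lemma axis_orbits_image:
  "insert (0, 0) (normal_flow (2, 0) ` {0..} \<union> (\<lambda>t. reflection (normal_flow (2, 0) t)) ` {0..}) = horizontal_diameter"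
    (is "?L = _")
proof (intro equalityI subsetI)
  fix z assume "z \<in> horizontal_diameter"
  then obtain u where z: "z = (u, 0)" "\<bar>u\<bar> \<le> 2" by (cases z) (auto simp: horizontal_diameter_def)
  \<comment> \<open>The solution of 2 / (1 + 2t) = |u|; it is nonnegative because |u| \<le>
    2.\<close>
  define t where "t = 1 / \<bar>u\<bar> - 1 / 2"
  have t: "1 + 2 * t = 2 / \<bar>u\<bar>" by (simp add: t_def)
  have t0: "0 \<le> t" if "u \<noteq> 0" using z that by (simp add: t_def le_divide_eq)
  consider "u = 0" | "u > 0" | "u < 0" by linarith
  then show "z \<in> ?L"
  proof cases
    case 2
    then have "0 \<le> t" "normal_flow (2, 0) t = z" using z
      by (simp_all add: t t0 axis_orbit)
    then show ?thesis by force
  next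
    case 3
    then have "0 \<le> t" "reflection (normal_flow (2, 0) t) = z"
      using z by (simp_all add: t t0 axis_orbit reflection_def)
    then show ?thesis by force
  qed (use z in simp)
next
  fix z assume "z \<in> ?L"
  then show "z \<in> horizontal_diameter"
    by (auto simp: horizontal_diameter_def axis_orbit divide_le_eq)
qed

text \<open>The circle is cut at (2, 0) and (-2, 0). Both sectors have the u-axis as their pair of
  bounding orbits, and the upper and lower arcs tell them apart.\<close>

lemma sectorial_decomposition_normal_field:
  "sectorial_decomposition normal_field (0, 0) (cball 0 2) [Elliptic, Hyperbolic]"
proof -
  \<comment> \<open>Defining \<open>\<sigma>\<close> and \<open>c\<close> by parity makes the
    indices 0 and 2 agree, which closes the cycle of sectors.\<close>
  define s :: "nat \<Rightarrow> real" where "s i = real i / 2" for i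
  define \<sigma> :: "nat \<Rightarrow> bool" where "\<sigma> i = even i" for i
  define c where "c i = (if even i then normal_flow (2, 0)
    else (\<lambda>t. reflection (normal_flow (2, 0) t)))" for i :: nat
  have "characteristic_orbit (reversed normal_field) (0, 0) (sphere 0 2)
      (\<lambda>t. reflection (normal_flow (2, 0) t))"
    using reflection.characteristic_orbit_image[OF characteristic_axis_orbit]
      reflection_image_eqI[of "sphere 0 2"] unfolding mem_sphere_2_iff by simp
  with characteristic_axis_orbit have orbits: "\<forall>i<2. c i 0 = circle (s i) \<and>
      characteristic_orbit (if \<sigma> i then normal_field else reversed normal_field) (0, 0)
        (path_image circle) (c i)"
    by (auto simp: less_2_cases_iff c_def \<sigma>_def s_def path_image_circle circle_def reflection_def)
  have B: "insert (0, 0) (c i ` {0..} \<union> c (i + 1) ` {0..}) = horizontal_diameter" for i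
    using axis_orbits_image by (auto simp: c_def Un_commute)
  have S: "closed_disc (horizontal_diameter \<union> circle ` {s 0..s (0 + 1)}) = half_disc 1"
    "closed_disc (horizontal_diameter \<union> circle ` {s 1..s (1 + 1)}) = half_disc (-1)"
    by (simp_all add: s_def circle_upper_image circle_lower_image closed_disc_half_disc)
  have "\<forall>i<2. let B = insert (0, 0) (c i ` {0..} \<union> c (i + 1) ` {0..});
                    S = closed_disc (B \<union> circle ` {s i..s (i + 1)})
                in case [Elliptic, Hyperbolic] ! i of
                     Hyperbolic \<Rightarrow> \<sigma> i \<noteq> \<sigma> (i + 1) \<and> hyperbolic_sector normal_field S B
                   | Elliptic \<Rightarrow> \<sigma> i \<noteq> \<sigma> (i + 1) \<and> elliptic_sector normal_field (0, 0) S
                   | Parabolic \<Rightarrow> \<sigma> i = \<sigma> (i + 1) \<and> parabolic_sector normal_field (0, 0) S"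
    unfolding Let_def B less_2_cases_iff
    using S elliptic_sector_upper hyperbolic_sector_lower by (auto simp: \<sigma>_def)
  moreover have "(0, 0) \<in> inside (path_image circle)"
    by (simp add: path_image_circle inside_sphere zero_prod_def[symmetric])
  moreover have "cball 0 2 = closed_disc (path_image circle)"
    by (simp add: path_image_circle closed_disc_sphere)
  moreover have "pathfinish circle = pathstart circle"
    by (simp add: pathfinish_def pathstart_def circle_def)
  ultimately show ?thesis
    unfolding sectorial_decomposition_def using simple_path_circle orbits
    by (intro exI[of _ circle] exI[of _ s] exI[of _ c] exI[of _ \<sigma>] exI[of _ 2])
      (simp add: s_def c_def \<sigma>_def)
qed

section \<open>Degree of the system and its expression in the chart\<close>

lemma poly_le_2_I:
  assumes "\<And>x y. f (x, y) = A * y + B * x * y" shows "poly_le 2 f"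
proof -
  define a :: "nat \<Rightarrow> nat \<Rightarrow> real" where
    "a i j = (if i = 0 \<and> j = 1 then A else if i = 1 \<and> j = 1 then B else 0)" for i j
  have "f (x, y) = (\<Sum>i\<le>2. \<Sum>j\<le>2 - i. a i j * x ^ i * y ^ j)" for x y
    by (simp add: assms a_def numeral_2_eq_2)
  then show ?thesis unfolding poly_le_def by blast
qed

text \<open>The mixed difference over the corners of the unit square, f(1,1) - f(1,0) - f(0,1) +
  f(0,0), vanishes for degree at most 1 but equals 2b here.\<close>

lemma not_poly_le_product:
  assumes "b \<noteq> 0" "n < 2" shows "\<not> poly_le n (\<lambda>(x, y). 2 * b * x * y)"
proof
  assume "poly_le n (\<lambda>(x, y). 2 * b * x * y)"
  then obtain a where a: "\<And>x y. 2 * b * x * y = (\<Sum>i\<le>n. \<Sum>j\<le>n - i. a i j * x ^ i * y ^ j)"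
    unfolding poly_le_def by auto
  from assms have "n = 0 \<or> n = 1" by auto
  then show False
    using a[of 0 0] a[of 1 0] a[of 0 1] a[of 1 1] assms(1) by auto
qed

lemma vf_degree_quadratic:
  assumes "b \<noteq> 0" shows "vf_degree (\<lambda>(x, y). (y, 2 * b * x * y)) = 2"
  unfolding vf_degree_def
proof (rule Least_equality)
  show "poly_le 2 (\<lambda>z. fst (case z of (x, y) \<Rightarrow> (y, 2 * b * x * y))) \<and>
      poly_le 2 (\<lambda>z. snd (case z of (x, y) \<Rightarrow> (y, 2 * b * x * y)))"
    using poly_le_2_I[of _ 1 0] poly_le_2_I[of _ 0 "2 * b"] by simp
  fix n
  assume "poly_le n (\<lambda>z. fst (case z of (x, y) \<Rightarrow> (y, 2 * b * x * y))) \<and>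
      poly_le n (\<lambda>z. snd (case z of (x, y) \<Rightarrow> (y, 2 * b * x * y)))"
  then have "poly_le n (\<lambda>(x, y). 2 * b * x * y)" by (simp add: case_prod_unfold)
  then show "2 \<le> n" using not_poly_le_product[OF assms] by (meson not_le)
qed

definition chart_field :: "real \<Rightarrow> real \<times> real \<Rightarrow> real \<times> real" where
  "chart_field b = (\<lambda>(u, v). (v - 2 * b * u\<^sup>2, - 2 * b * u * v))"

lemma chart_U2_quadratic:
  assumes "b \<noteq> 0" shows "chart_U2 (\<lambda>(x, y). (y, 2 * b * x * y)) = chart_field b"
proof (rule ext)
  fix z :: "real \<times> real"
  obtain u v where z: "z = (u, v)" by fastforce
  have finite: "chart_U2_finite (\<lambda>(x, y). (y, 2 * b * x * y)) u w = (w - 2 * b * u\<^sup>2, - 2 * b * u * w)"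
    if "w \<noteq> 0" for w
    using that unfolding chart_U2_finite_def vf_degree_quadratic[OF assms] Let_def
    by (simp add: field_simps power2_eq_square power3_eq_cube)
  \<comment> \<open>On the line at infinity the chart value is a limit, obtained from the continuity
    of the cancelled formula.\<close>
  have "((\<lambda>w. (w - 2 * b * u\<^sup>2, - 2 * b * u * w)) \<longlongrightarrow> (0 - 2 * b * u\<^sup>2, - 2 * b * u * 0)) (at 0)"
    by (intro tendsto_intros)
  then have "(chart_U2_finite (\<lambda>(x, y). (y, 2 * b * x * y)) u \<longlongrightarrow>
      (0 - 2 * b * u\<^sup>2, - 2 * b * u * 0)) (at 0)"
    by (rule Lim_transform_eventually) (simp add: finite eventually_at_filter)
  then have "Lim (at 0) (chart_U2_finite (\<lambda>(x, y). (y, 2 * b * x * y)) u) =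
      (0 - 2 * b * u\<^sup>2, - 2 * b * u * 0)"
    by (intro tendsto_Lim) simp
  then show "chart_U2 (\<lambda>(x, y). (y, 2 * b * x * y)) z = chart_field b z"
    by (simp add: z chart_U2_def chart_field_def finite)
qed

section \<open>From the normal form to small neighbourhoods in the chart\<close>

text \<open>The normal form is quasi-homogeneous: scaling u by c and v by c^2 only multiplies time
  by a constant. The factor 1/(2b) restores the coefficient; for b < 0 it also adds a half turn,
  which moves the elliptic sector to the side v < 0.\<close>

lemma chart_field_conjugacy:
  assumes "b \<noteq> 0" "0 < c"
  shows "field_conjugacy (\<lambda>z. (c / (2 * b) * fst z, c\<^sup>2 / (2 * b) * snd z)) c normal_field (chart_field b)"
proof (rule field_conjugacy.intro)
  let ?f = "\<lambda>z. (c / (2 * b) * fst z, c\<^sup>2 / (2 * b) * snd z)"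
  show "linear ?f" by (rule linearI) (simp_all add: algebra_simps add_divide_distrib)
  show "bij ?f"
    using assms by (intro o_bij[of "\<lambda>z. (2 * b / c * fst z, 2 * b / c\<^sup>2 * snd z)"]) (auto simp: o_def)
  show "chart_field b (?f z) = c *\<^sub>R ?f (normal_field z)" for z
    using assms
    by (cases z) (simp add: chart_field_def normal_field_def field_simps power2_eq_square)
qed (rule assms)

lemma isolated_critical_point_chart_field:
  assumes "b \<noteq> 0" shows "isolated_critical_point (chart_field b) (0, 0)"
proof -
  have "chart_field b z \<noteq> 0" if "z \<noteq> (0, 0)" for z
    using that assms by (cases z) (auto simp: chart_field_def zero_prod_def)
  then have "\<forall>\<^sub>F z in at (0, 0). chart_field b z \<noteq> 0"
    by (simp add: eventually_at_filter)
  then show ?thesis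
    by (simp add: isolated_critical_point_def) (simp add: chart_field_def zero_prod_def)
qed

lemma has_sectors_chart_field:
  assumes "b \<noteq> 0" shows "has_sectors (chart_field b) (0, 0) 1 1"
  unfolding has_sectors_def
proof (intro conjI allI impI)
  show "isolated_critical_point (chart_field b) (0, 0)"
    using assms by (rule isolated_critical_point_chart_field)
  fix U :: "(real \<times> real) set" assume "open U \<and> (0, 0) \<in> U"
  then obtain e where e: "0 < e" "ball (0, 0) e \<subseteq> U" using open_contains_ball by metis
  \<comment> \<open>Since c \<le> 1 gives c^2 \<le> c, points of the disc of radius 2 are mapped to
    norm at most 2c/|b|, which is at most 2e/3.\<close>
  define c where "c = min 1 (e * \<bar>b\<bar> / 3)"
  have c: "0 < c" "c \<le> 1" "c \<le> e * \<bar>b\<bar> / 3" using e assms by (simp_all add: c_def)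
  define f where "f z = (c / (2 * b) * fst z, c\<^sup>2 / (2 * b) * snd z)" for z :: "real \<times> real"
  interpret field_conjugacy f c normal_field "chart_field b"
    unfolding f_def using assms c(1) by (rule chart_field_conjugacy)
  have "f ` cball 0 2 \<subseteq> ball (0, 0) e"
  proof (rule image_subsetI)
    fix z :: "real \<times> real" assume "z \<in> cball 0 2"
    moreover obtain u v where z: "z = (u, v)" by fastforce
    ultimately have "norm (u, v) \<le> 2" by simp
    then have uv: "\<bar>u\<bar> \<le> 2" "\<bar>v\<bar> \<le> 2"
      using norm_fst_le[of u v] norm_snd_le[of v u] by (auto intro: order_trans)
    have "c\<^sup>2 \<le> c" using c by (simp add: power2_eq_square)
    have "norm (f (u, v)) \<le> norm (c / (2 * b) * u) + norm (c\<^sup>2 / (2 * b) * v)"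
      unfolding f_def fst_conv snd_conv by (rule norm_Pair_le)
    also have "\<dots> = (c * \<bar>u\<bar> + c\<^sup>2 * \<bar>v\<bar>) / (2 * \<bar>b\<bar>)"
      using c by (simp add: abs_mult add_divide_distrib)
    also have "\<dots> \<le> (c * 2 + c * 2) / (2 * \<bar>b\<bar>)"
      using c uv \<open>c\<^sup>2 \<le> c\<close> by (intro divide_right_mono add_mono mult_mono) auto
    also have "\<dots> < e" using c assms e by (simp add: field_simps)
    finally show "f z \<in> ball (0, 0) e" by (simp add: z zero_prod_def[symmetric])
  qed
  with e have "f ` cball 0 2 \<subseteq> U" by blast
  moreover have "sectorial_decomposition (chart_field b) (0, 0) (f ` cball 0 2) [Elliptic, Hyperbolic]"
    using sectorial_decomposition_image[OF sectorial_decomposition_normal_field]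
    by (simp add: f_def)
  ultimately show "\<exists>V ks. V \<subseteq> U \<and> sectorial_decomposition (chart_field b) (0, 0) V ks \<and>
      count_list ks Hyperbolic = 1 \<and> count_list ks Elliptic = 1"
    by (intro exI[of _ "f ` cball 0 2"] exI[of _ "[Elliptic, Hyperbolic]"]) simp
qed

theorem proposition6p2:
  fixes b :: real and X :: "real \<times> real \<Rightarrow> real \<times> real"
  assumes "b \<noteq> 0"
    and "X = (\<lambda>(x, y). (y, 2 * b * x * y))"
  shows "chart_U2 X = (\<lambda>(u, v). (v - 2 * b * u\<^sup>2, - 2 * b * u * v)) \<and>
         has_sectors (chart_U2 X) (0, 0) 1 1"
  using chart_U2_quadratic[OF assms(1)] has_sectors_chart_field[OF assms(1)] assms(2)
  by (simp add: chart_field_def)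

end
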